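(* Let $\mathcal C\subseteq\mathbb N$ be a ruleset that contains an even number. Then the Sprague-Grundy sequence $(\mathcal G(n))_{n\ge 1}$ of the partition game with ruleset $\mathcal C$ is unbounded. In particular, if $c$ is the smallest even element of $\mathcal C$, then for every $x\in\mathbb N$ the values $\mathcal G(x),\mathcal G(x+c),\mathcal G(x+2c),\ldots$ along the arithmetic progression $x,x+c,x+2c,\ldots$ are pairwise distinct (and hence the progression contains infinitely many $\mathcal G$-values).
   Context: $\mathbb N=\{1,2,\ldots\}$ and $\mathbb N_0=\mathbb N\cup\{0\}$. A ruleset is a set $\mathcal C\subseteq\mathbb N$ (possibly infinite) of allowed cut-numbers. In the partition game with ruleset $\mathcal C$, positions are finite collections (disjunctive sums) of heaps of positive integer sizes; a move chooses one heap, of size $n$, chooses $c\in\mathcal C$, and replaces that heap by $c+1$ heaps of positive integer sizes $n_0,\ldots,n_c$ with $n_0+\cdots+n_c=n$ (a $c$-cut). The Sprague-Grundy value of a single heap of size $n\ge1$ is defined recursively by $$\mathcal G(n)=\operatorname{mex}\{\mathcal G(n_0)\oplus\cdots\oplus\mathcal G(n_c)\mid c\in\mathcal C,\ n_i\in\mathbb N,\ n_0+\cdots+n_c=n\},$$ where $\oplus$ is nim-sum (bitwise XOR) and $\operatorname{mex}(U)=\min(\mathbb N_0\setminus U)$. *)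

theory Defs
  imports Complex_Main
begin

definition mex :: "nat set \<Rightarrow> nat" where
  "mex U = (LEAST m. m \<notin> U)"

definition nim_sum :: "nat list \<Rightarrow> nat" where
  "nim_sum us = foldr xor us 0"

text \<open>
  The results of the legal moves on a heap of size \<open>n\<close>, as the lists
  \<open>[n\<^sub>0, \<dots>, n\<^sub>c]\<close> of new heap sizes. A ruleset is a set of positive
  integers; the condition \<open>0 < c\<close> is implied by \<open>c \<in> C\<close> for such sets and only serves
  to make \<open>grundy\<close> below well-defined for every \<open>C :: nat set\<close>.
\<close>

definition cuts :: "nat set \<Rightarrow> nat \<Rightarrow> nat list set" where
  "cuts C n = {ns. \<exists>c\<in>C. 0 < c \<and> length ns = c + 1 \<and> (\<forall>m\<in>set ns. 0 < m) \<and> sum_list ns = n}"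

lemma cuts_less:
  assumes "ns \<in> cuts C n" and "m \<in> set ns"
  shows "m < n"
proof -
  from assms have len: "length ns \<ge> 2" and pos: "\<forall>k\<in>set ns. 0 < k" and n: "sum_list ns = n"
    by (auto simp: cuts_def)
  from assms(2) obtain xs ys where ns: "ns = xs @ m # ys"
    by (auto simp: in_set_conv_decomp)
  with len have "xs @ ys \<noteq> []" by auto
  then obtain k where "k \<in> set (xs @ ys)" by (meson last_in_set)
  then have "0 < k" "k \<le> sum_list (xs @ ys)"
    using pos ns by (simp_all only: member_le_sum_list) auto
  then show ?thesis using n ns by simp
qed

text \<open>
  Sizes are positive, so \<open>grundy C 0\<close> has no game-theoretic meaning; no legal move
  produces an empty heap.
\<close>

function grundy :: "nat set \<Rightarrow> nat \<Rightarrow> nat" where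
  "grundy C n = mex ((\<lambda>ns. nim_sum (map (grundy C) ns)) ` cuts C n)"
  by auto
termination
  by (relation "measure snd") (auto dest: cuts_less)

declare grundy.simps [simp del]

lemma finite_cuts: "finite (cuts C n)"
proof (rule finite_subset)
  have len: "length ns \<le> sum_list ns" if "\<forall>m\<in>set ns. 0 < m" for ns :: "nat list"
    using that by (induction ns) auto
  show "cuts C n \<subseteq> {ns. set ns \<subseteq> {..n} \<and> length ns \<le> n}"
  proof
    fix ns assume ns: "ns \<in> cuts C n"
    then have "length ns \<le> n" using len[of ns] unfolding cuts_def by blast
    moreover have "set ns \<subseteq> {..n}" using cuts_less[OF ns] less_imp_le by blast
    ultimately show "ns \<in> {ns. set ns \<subseteq> {..n} \<and> length ns \<le> n}" by blast
  qed
  show "finite {ns. set ns \<subseteq> {..n} \<and> length ns \<le> n}"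
    by (rule finite_lists_length_le) simp
qed

end

theory Submission
  imports Defs
begin

text \<open>
  Let \<open>c \<in> C\<close> be even. A heap of size \<open>x + d * c\<close> with \<open>d > 0\<close> can be cut into one heap
  of size \<open>x\<close> and \<open>c\<close> equal heaps of size \<open>d\<close>. The equal heaps cancel in pairs in the
  nim-sum, so this option has value \<open>grundy C x\<close>, and the mex rule gives
  \<open>grundy C (x + d * c) \<noteq> grundy C x\<close>. Any two terms of the progression
  \<open>x, x + c, x + 2 * c, \<dots>\<close> are related in this way, so the values along it are pairwise
  distinct; an infinite set of naturals is unbounded.
\<close>

text \<open>Finiteness is what guarantees that some natural number is missing from \<open>U\<close>.\<close>

lemma mex_notin:
  assumes "finite U"
  shows "mex U \<notin> U"
  unfolding mex_def using ex_new_if_finite[OF infinite_UNIV_nat assms] by (rule LeastI_ex)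

lemma nim_sum_replicate_even:
  assumes "even c"
  shows "nim_sum (replicate c a) = 0"
proof -
  have cancel: "nim_sum (a # a # us) = nim_sum us" for us
    unfolding nim_sum_def foldr.simps o_apply by (metis xor.assoc xor_self_eq xor.left_neutral)
  have "nim_sum (replicate (2 * m) a) = 0" for m
    by (induction m) (simp_all add: cancel nim_sum_def[of "[]"])
  with assms show ?thesis by (auto elim: evenE)
qed

lemma grundy_neq_option:
  assumes "ns \<in> cuts C n"
  shows "grundy C n \<noteq> nim_sum (map (grundy C) ns)"
  using mex_notin[OF finite_imageI[OF finite_cuts]] assms
  by (subst grundy.simps) blast

text \<open>The move to \<open>x\<close> together with \<open>c\<close> copies of \<open>d\<close> has the value of \<open>x\<close> alone.\<close>

lemma grundy_add_mult_even_cut_neq: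
  assumes "c \<in> C" "even c" "0 < c" "0 < x" "0 < d"
  shows "grundy C (x + d * c) \<noteq> grundy C x"
proof -
  have "x # replicate c d \<in> cuts C (x + d * c)"
    using assms by (auto simp: cuts_def sum_list_replicate mult.commute)
  from grundy_neq_option[OF this] show ?thesis
    using nim_sum_replicate_even[OF \<open>even c\<close>, of "grundy C d"]
    by (simp add: nim_sum_def)
qed

lemma inj_grundy_progression:
  assumes "c \<in> C" "even c" "0 < c" "0 < x"
  shows "inj (\<lambda>k::nat. grundy C (x + k * c))"
proof (rule linorder_injI)
  fix j k :: nat
  assume "j < k"
  then have "x + k * c = (x + j * c) + (k - j) * c"
    by (metis add.assoc add_mult_distrib le_add_diff_inverse less_imp_le)
  moreover have "grundy C ((x + j * c) + (k - j) * c) \<noteq> grundy C (x + j * c)"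
    using assms \<open>j < k\<close> by (intro grundy_add_mult_even_cut_neq) auto
  ultimately show "grundy C (x + j * c) \<noteq> grundy C (x + k * c)"
    by metis
qed

theorem theorem2:
  fixes C :: "nat set"
  assumes "C \<subseteq> {1..}" and "\<exists>c\<in>C. even c"
  shows "\<not> bdd_above (grundy C ` {1..}) \<and>
    (\<forall>c x. c = (LEAST d. d \<in> C \<and> even d) \<longrightarrow> 1 \<le> x \<longrightarrow>
      inj (\<lambda>k::nat. grundy C (x + k * c)) \<and>
      infinite (range (\<lambda>k::nat. grundy C (x + k * c))))"
proof -
  define c where "c = (LEAST d. d \<in> C \<and> even d)"
  have "c \<in> C \<and> even c"
    unfolding c_def by (rule LeastI_ex) (use assms(2) in blast)
  then have inj: "inj (\<lambda>k::nat. grundy C (x + k * c))" if "1 \<le> x" for x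
    using that assms(1) by (intro inj_grundy_progression) auto
  then have inf: "infinite (range (\<lambda>k::nat. grundy C (x + k * c)))" if "1 \<le> x" for x
    using finite_imageD[OF _ inj[OF that]] by auto
  have "range (\<lambda>k::nat. grundy C (1 + k * c)) \<subseteq> grundy C ` {1..}"
    by auto
  then have "infinite (grundy C ` {1..})"
    using inf[of 1] finite_subset by blast
  then have "\<not> bdd_above (grundy C ` {1..})"
    by (simp add: bdd_above_nat)
  with inj inf show ?thesis by (simp flip: c_def)
qed

end
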